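(* Let $W$ be an irreducible $T$-module with endpoint $r$ and diameter $d=D-2r$. Let $u\in E_rW$, $u^*\in E_r^*W$, $u^{\varepsilon}\in E_r^{\varepsilon}W$ be nonzero vectors. Consider the $(d+1)\times(d+1)$ tridiagonal matrix $$B=\mathbf{i}\begin{pmatrix}0&d&&&&0\\-1&0&d-1&&&\\&-2&\cdot&\cdot&&\\&&\cdot&\cdot&\cdot&\\&&&\cdot&\cdot&1\\0&&&&-d&0\end{pmatrix},$$ i.e. $B_{i,i-1}=-\mathbf{i}\,i$ for $1\le i\le d$, $B_{i,i+1}=\mathbf{i}(d-i)$ for $0\le i\le d-1$, and all other entries are $0$. Then the following hold. (i) $B$ represents $A$ with respect to the basis $E^{\varepsilon}_ru^*,\ldots,E^{\varepsilon}_{r+d}u^*$ of $W$. (ii) $B$ represents $A^*$ with respect to the basis $E_ru^{\varepsilon},\ldots,E_{r+d}u^{\varepsilon}$ of $W$. (iii) $B$ represents $A^{\varepsilon}$ with respect to the basis $E^*_ru,\ldots,E^*_{r+d}u$ of $W$.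
   Context: Let $D$ be a positive integer and let $Q_D$ be the $D$-cube: the graph with vertex set $X=\{0,1\}^D$, two vertices being adjacent iff they differ in exactly one coordinate; $\partial$ denotes path-length distance. $\mathrm{Mat}_X(\mathbb{C})$ is the algebra of complex matrices with rows and columns indexed by $X$, acting on $V=\mathbb{C}^X$ (column vectors) by left multiplication. Write $\mathbf{i}^2=-1$ (the bold $\mathbf{i}$ is the imaginary unit; the plain $i$ is an index). Let $A$ be the adjacency matrix of $Q_D$. Fix $x=(0,0,\ldots,0)\in X$. Let $A^*$ be the diagonal matrix in $\mathrm{Mat}_X(\mathbb{C})$ with $(y,y)$-entry $D-2\partial(x,y)$ for $y\in X$, and let $A^{\varepsilon}=-\mathbf{i}(AA^*-A^*A)/2$. Let $T$ be the subalgebra of $\mathrm{Mat}_X(\mathbb{C})$ generated by $A$ and $A^*$. The eigenvalues of $A$ are $\theta_i=D-2i$ $(0\le i\le D)$. For $0\le i\le D$: $E_i=\prod_{0\le j\le D,\,j\ne i}\frac{A-\theta_jI}{\theta_i-\theta_j}$ is the primitive idempotent of $A$ for $\theta_i$ (the orthogonal projection onto the $\theta_i$-eigenspace of $A$); $E_i^*$ is the diagonal matrix with $(y,y)$-entry $1$ if $\partial(x,y)=i$ and $0$ otherwise; and $E_i^{\varepsilon}=P^{-1}E_iP$, where $P=P_1^{\otimes D}$ (Kronecker power, $P_{yz}=\prod_{k=1}^D(P_1)_{y_kz_k}$, invertible) with $P_1=\begin{pmatrix}1&1\\-\mathbf{i}&\mathbf{i}\end{pmatrix}$, rows and columns indexed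 by $0,1$ in that order. ($E_i^*$ and $E_i^{\varepsilon}$ are the primitive idempotents of $A^*$ and $A^{\varepsilon}$ for the eigenvalue $D-2i$.) A $T$-module is a subspace $W\subseteq V$ with $BW\subseteq W$ for all $B\in T$; it is irreducible if $W\ne0$ and it contains no $T$-modules other than $0$ and $W$. The endpoint of an irreducible $T$-module $W$ is $r=\min\{i\mid 0\le i\le D,\ E_i^*W\neq0\}$ (it is known that also $r=\min\{i\mid E_iW\ne0\}$), and its diameter is $d=|\{i\mid 0\le i\le D,\ E_i^*W\ne0\}|-1$; it is known that $d=D-2r$ and $0\le r\le D/2$. For nonzero $u\in E_rW$, $u^*\in E^*_rW$, $u^{\varepsilon}\in E^{\varepsilon}_rW$, each of the six sequences $(E^*_{r+i}u)_{i=0}^d$, $(E^{\varepsilon}_{r+i}u)_{i=0}^d$, $(E^{\varepsilon}_{r+i}u^* )_{i=0}^d$, $(E_{r+i}u^* )_{i=0}^d$, $(E_{r+i}u^{\varepsilon})_{i=0}^d$, $(E^*_{r+i}u^{\varepsilon})_{i=0}^d$ is a basis of $W$. Convention: a $(d+1)\times(d+1)$ matrix $B$ (rows and columns indexed $0,\ldots,d$) represents $Y\in T$ with respect to a basis $v_0,\ldots,v_d$ of $W$ if $Yv_j=\sum_{i=0}^dB_{ij}v_i$ for $0\le j\le d$. *)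

theory Defs
  imports "HOL-Analysis.Analysis"
begin

text \<open>
  The cube dimension \<open>D\<close> is \<open>CARD('n)\<close> for an arbitrary finite index type \<open>'n\<close>; vertices are
  elements of \<open>bool ^ 'n\<close>, with \<open>False\<close>, \<open>True\<close> standing for the coordinates 0, 1.
  In \<open>'n cmat\<close> the entry in row \<open>y\<close> and column \<open>z\<close> of \<open>M\<close> is \<open>M $ y $ z\<close>.
\<close>

type_synonym 'n vert = "bool ^ 'n"
type_synonym 'n cvec = "complex ^ (bool ^ 'n)"
type_synonym 'n cmat = "complex ^ (bool ^ 'n) ^ (bool ^ 'n)"

definition mat_scale :: "complex \<Rightarrow> ('n::finite) cmat \<Rightarrow> 'n cmat" where
  "mat_scale c M = (\<chi> y z. c * M $ y $ z)"

definition cube_adj :: "('n::finite) vert \<Rightarrow> 'n vert \<Rightarrow> bool" where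
  "cube_adj y z \<longleftrightarrow> card {k. y $ k \<noteq> z $ k} = 1"

text \<open>Path-length distance: the least length of a walk from \<open>y\<close> to \<open>z\<close>.\<close>

definition cube_dist :: "('n::finite) vert \<Rightarrow> 'n vert \<Rightarrow> nat" where
  "cube_dist y z = (LEAST l. (y, z) \<in> {(a, b). cube_adj a b} ^^ l)"

definition base_vertex :: "('n::finite) vert" where
  "base_vertex = (\<chi> k. False)"

definition theta :: "'n::finite itself \<Rightarrow> nat \<Rightarrow> complex" where
  "theta _ i = of_nat CARD('n) - 2 * of_nat i"

definition adj_A :: "('n::finite) cmat" where
  "adj_A = (\<chi> y z. if cube_adj y z then 1 else 0)"

definition dual_A :: "('n::finite) cmat" where
  "dual_A = (\<chi> y z. if y = z then theta TYPE('n) (cube_dist base_vertex y) else 0)"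

definition eps_A :: "('n::finite) cmat" where
  "eps_A = mat_scale (- \<i> / 2) (adj_A ** dual_A - dual_A ** adj_A)"

text \<open>
  The product over \<open>j \<noteq> i\<close> is taken along the list \<open>0, \<dots>, D\<close>, because \<open>*\<close> on \<open>_ ^ _\<close> is the
  entrywise product, so that \<open>\<Prod>\<close> does not denote a product of matrices.
\<close>

definition idem_E :: "nat \<Rightarrow> ('n::finite) cmat" where
  "idem_E i = foldr (**)
     (map (\<lambda>j. mat_scale (1 / (theta TYPE('n) i - theta TYPE('n) j))
                 (adj_A - mat_scale (theta TYPE('n) j) (mat 1)))
        (filter (\<lambda>j. j \<noteq> i) [0..<Suc CARD('n)]))
     (mat 1)"

definition dual_E :: "nat \<Rightarrow> ('n::finite) cmat" where
  "dual_E i = (\<chi> y z. if y = z \<and> cube_dist base_vertex y = i then 1 else 0)"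

definition P1 :: "bool \<Rightarrow> bool \<Rightarrow> complex" where
  "P1 a b = (if a then (if b then \<i> else - \<i>) else 1)"

definition P_mat :: "('n::finite) cmat" where
  "P_mat = (\<chi> y z. \<Prod>k\<in>UNIV. P1 (y $ k) (z $ k))"

definition eps_E :: "nat \<Rightarrow> ('n::finite) cmat" where
  "eps_E i = matrix_inv P_mat ** idem_E i ** P_mat"

inductive_set T_alg :: "('n::finite) cmat set" where
  one: "mat 1 \<in> T_alg"
| gen_A: "adj_A \<in> T_alg"
| gen_dual_A: "dual_A \<in> T_alg"
| add: "M \<in> T_alg \<Longrightarrow> N \<in> T_alg \<Longrightarrow> M + N \<in> T_alg"
| scale: "M \<in> T_alg \<Longrightarrow> mat_scale c M \<in> T_alg"
| mult: "M \<in> T_alg \<Longrightarrow> N \<in> T_alg \<Longrightarrow> M ** N \<in> T_alg"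

definition T_module :: "('n::finite) cvec set \<Rightarrow> bool" where
  "T_module W \<longleftrightarrow> vec.subspace W \<and> (\<forall>M\<in>T_alg. \<forall>w\<in>W. M *v w \<in> W)"

definition irreducible_T_module :: "('n::finite) cvec set \<Rightarrow> bool" where
  "irreducible_T_module W \<longleftrightarrow> T_module W \<and> W \<noteq> {0} \<and>
     (\<forall>U. T_module U \<and> U \<subseteq> W \<longrightarrow> U = {0} \<or> U = W)"

definition dual_support :: "('n::finite) cvec set \<Rightarrow> nat set" where
  "dual_support W = {i. i \<le> CARD('n) \<and> (*v) (dual_E i) ` W \<noteq> {0}}"

definition endpoint :: "('n::finite) cvec set \<Rightarrow> nat" where
  "endpoint W = Min (dual_support W)"

definition module_diameter :: "('n::finite) cvec set \<Rightarrow> nat" where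
  "module_diameter W = card (dual_support W) - 1"

definition is_basis :: "nat \<Rightarrow> (nat \<Rightarrow> ('n::finite) cvec) \<Rightarrow> 'n cvec set \<Rightarrow> bool" where
  "is_basis d v W \<longleftrightarrow>
     inj_on v {0..d} \<and> vec.independent (v ` {0..d}) \<and> vec.span (v ` {0..d}) = W"

text \<open>
  Matrices of size \<open>d + 1\<close> are functions on indices; only entries with both indices in
  \<open>{0..d}\<close> matter.
\<close>

definition represents ::
  "nat \<Rightarrow> (nat \<Rightarrow> nat \<Rightarrow> complex) \<Rightarrow> ('n::finite) cmat \<Rightarrow> (nat \<Rightarrow> 'n cvec) \<Rightarrow> 'n cvec set \<Rightarrow> bool"
where
  "represents d B Y v W \<longleftrightarrow>
     is_basis d v W \<and> (\<forall>j\<in>{0..d}. Y *v v j = (\<Sum>i=0..d. B i j *s v i))"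

definition B_mat :: "nat \<Rightarrow> nat \<Rightarrow> nat \<Rightarrow> complex" where
  "B_mat d i j =
     (if i = j + 1 then - \<i> * of_nat i
      else if j = i + 1 then \<i> * (of_nat d - of_nat i)
      else 0)"

end

theory Submission
  imports Defs
begin

text \<open>
  The matrices \<open>A\<close>, \<open>A\<^sup>*\<close>, \<open>A\<^sup>\<epsilon>\<close> satisfy \<open>[X, Y] = 2\<i>Z\<close> and its cyclic shifts, so \<open>T\<close> is a quotient of
  the enveloping algebra of \<open>sl\<^sub>2\<close>. Let \<open>u\<close> be an eigenvector of \<open>X\<close> in \<open>W\<close> whose eigenvalue
  \<open>D - 2r\<close> is the largest one on \<open>W\<close>. Since \<open>Y + \<i>Z\<close> raises eigenvalues of \<open>X\<close>, it kills \<open>u\<close>. The operators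
  \<open>R = Z + \<i>X\<close> and \<open>L = Z - \<i>X\<close> shift the eigenspaces of \<open>Y\<close>, and \<open>Yu = -\<i>Zu\<close>, \<open>Xu = (D - 2r)u\<close>
  express \<open>Ru\<close> and \<open>Lu\<close> through \<open>u\<close> and \<open>Yu\<close>. Taking \<open>Y\<close>-components \<open>w\<^sub>k\<close> of \<open>u\<close> gives
  \<open>R w\<^sub>k\<^sub>+\<^sub>1 = 2\<i>(D - r - k) w\<^sub>k\<close> and \<open>L w\<^sub>k\<^sub>-\<^sub>1 = 2\<i>(r - k) w\<^sub>k\<close>. These recurrences show that exactly the \<open>w\<^sub>k\<close> with
  \<open>r \<le> k \<le> D - r\<close> are nonzero, and \<open>2Z = R + L\<close> is the matrix \<open>B\<close> in the
  basis formed by them. The three parts of the theorem are the three cyclic shifts of this statement;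
  it also shows that \<open>W\<close> has the same support with respect to each of the three matrices.
\<close>

section \<open>Spectral families\<close>

definition invariant_under :: "'n::finite cvec set \<Rightarrow> 'n cmat \<Rightarrow> bool" where
  "invariant_under W M \<longleftrightarrow> (\<forall>w\<in>W. M *v w \<in> W)"

definition weight :: "nat \<Rightarrow> nat \<Rightarrow> complex" where
  "weight D k = of_nat D - 2 * of_nat k"

text \<open>A resolution of the identity into eigenprojections of \<open>Y\<close>, some of which
  may be zero. Idempotence and orthogonality are consequences, see
  \<open>spectral_mult\<close>.\<close>

definition spectral_family :: "nat \<Rightarrow> 'n::finite cmat \<Rightarrow> (nat \<Rightarrow> 'n cmat) \<Rightarrow> bool" where
  "spectral_family D Y F \<longleftrightarrow>
     (\<forall>v. (\<Sum>k\<le>D. F k *v v) = v) \<and>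
     (\<forall>k\<le>D. \<forall>v. Y *v (F k *v v) = weight D k *s (F k *v v) \<and>
                F k *v (Y *v v) = weight D k *s (F k *v v))"

definition spectral_support ::
  "nat \<Rightarrow> (nat \<Rightarrow> 'n::finite cmat) \<Rightarrow> 'n cvec set \<Rightarrow> nat set" where
  "spectral_support D F W = {k. k \<le> D \<and> (*v) (F k) ` W \<noteq> {0}}"

definition cyclic_triple :: "'n::finite cmat \<Rightarrow> 'n cmat \<Rightarrow> 'n cmat \<Rightarrow> bool" where
  "cyclic_triple X Y Z \<longleftrightarrow>
     (\<forall>v. X *v (Y *v v) - Y *v (X *v v) = (2 * \<i>) *s (Z *v v)) \<and>
     (\<forall>v. Y *v (Z *v v) - Z *v (Y *v v) = (2 * \<i>) *s (X *v v)) \<and>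
     (\<forall>v. Z *v (X *v v) - X *v (Z *v v) = (2 * \<i>) *s (Y *v v))"

lemma cyclic_triple_rotate: "cyclic_triple X Y Z \<Longrightarrow> cyclic_triple Y Z X"
  by (auto simp: cyclic_triple_def)

lemma mat_scale_mult_vec: "mat_scale c M *v v = c *s (M *v v)"
  by (simp add: mat_scale_def matrix_vector_mult_def vec_eq_iff sum_distrib_left mult.assoc)

lemma matrix_vector_mult_sum:
  fixes M :: "complex^'m::finite^'l::finite"
  shows "M *v (\<Sum>i\<in>I. f i) = (\<Sum>i\<in>I. M *v f i)"
  by (induction I rule: infinite_finite_induct) (simp_all add: matrix_vector_right_distrib)

lemma weight_eq_iff [simp]: "weight D k = weight D l \<longleftrightarrow> k = l"
  by (simp add: weight_def)

text \<open>Equality would be an equation between natural numbers, by injectivity of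
  \<open>of_nat\<close>. The two rules serve operators that raise or lower eigenvalues by 2.\<close>

lemma weight_shift_neq:
  "int l \<noteq> int k + 1 \<Longrightarrow> weight D k \<noteq> weight D l + 2"
  "int k \<noteq> int l + 1 \<Longrightarrow> weight D k \<noteq> weight D l + - 2"
proof -
  have "weight D k = weight D l + 2 \<longleftrightarrow> (of_nat (2 * l) :: complex) = of_nat (2 * k + 2)"
    "weight D k = weight D l + - 2 \<longleftrightarrow> (of_nat (2 * k) :: complex) = of_nat (2 * l + 2)"
    by (auto simp: weight_def algebra_simps)
  then show "int l \<noteq> int k + 1 \<Longrightarrow> weight D k \<noteq> weight D l + 2"
    "int k \<noteq> int l + 1 \<Longrightarrow> weight D k \<noteq> weight D l + - 2"
    unfolding of_nat_eq_iff by auto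
qed

lemma spectral_familyD:
  assumes "spectral_family D Y F"
  shows "(\<Sum>k\<le>D. F k *v v) = v"
    "k \<le> D \<Longrightarrow> Y *v (F k *v v) = weight D k *s (F k *v v)"
    "k \<le> D \<Longrightarrow> F k *v (Y *v v) = weight D k *s (F k *v v)"
  using assms by (simp_all add: spectral_family_def)

lemma spectral_eq_0I:
  assumes "spectral_family D Y F" and "\<And>k. k \<le> D \<Longrightarrow> F k *v v = 0"
  shows "v = 0"
  using spectral_familyD(1)[OF assms(1), of v] assms(2) by simp

text \<open>Placed between two projections, \<open>Y\<close> acts by either weight, which forces
  orthogonality; idempotence follows by expanding \<open>v\<close> over all projections.\<close>

lemma spectral_mult:
  assumes F: "spectral_family D Y F" and k: "k \<le> D" and l: "l \<le> D"
  shows "F k *v (F l *v v) = (if k = l then F k *v v else 0)"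
proof -
  have orth: "F a *v (F b *v w) = 0" if "a \<le> D" "b \<le> D" "a \<noteq> b" for a b w
  proof -
    have "weight D a *s (F a *v (F b *v w)) = F a *v (Y *v (F b *v w))"
      using that by (simp only: spectral_familyD(3)[OF F])
    also have "\<dots> = weight D b *s (F a *v (F b *v w))"
      using that by (simp only: spectral_familyD(2)[OF F] vector_scalar_commute)
    finally show ?thesis using that by simp
  qed
  show ?thesis
  proof (cases "k = l")
    case True
    have "F k *v v = F k *v (\<Sum>j\<le>D. F j *v v)"
      using F by (simp add: spectral_family_def)
    also have "\<dots> = (\<Sum>j\<le>D. if j = k then F k *v (F k *v v) else 0)"
      unfolding matrix_vector_mult_sum by (rule sum.cong) (auto simp: orth k)
    also have "\<dots> = F k *v (F k *v v)" using k by simp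
    finally show ?thesis using True by simp
  qed (simp add: orth k l)
qed

text \<open>Moving \<open>Y\<close> past \<open>M\<close> adds \<open>c\<close> to the eigenvalue,
  so \<open>M *v (F l *v v)\<close> has no component of another weight.\<close>

lemma spectral_shift_zero:
  assumes F: "spectral_family D Y F" and k: "k \<le> D" and l: "l \<le> D"
    and M: "\<And>v. Y *v (M *v v) = M *v (Y *v v) + c *s (M *v v)"
    and neq: "weight D k \<noteq> weight D l + c"
  shows "F k *v (M *v (F l *v v)) = 0"
proof -
  let ?w = "F k *v (M *v (F l *v v))"
  have "weight D k *s ?w = F k *v (Y *v (M *v (F l *v v)))"
    using F k by (simp add: spectral_family_def)
  also have "\<dots> = (weight D l + c) *s ?w"
    using F l by (simp add: spectral_family_def M matrix_vector_right_distrib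
        vector_scalar_commute vector_sadd_rdistrib)
  finally show ?thesis using neq by (simp only: vec.scale_cancel_right) simp
qed

text \<open>Both sides equal \<open>F k *v (M *v (F l *v v))\<close>: expand the argument of
  \<open>M\<close> on the left and its result on the right, and drop the terms of wrong
  weight.\<close>

lemma spectral_shift:
  assumes F: "spectral_family D Y F" and k: "k \<le> D" and l: "l \<le> D"
    and M: "\<And>v. Y *v (M *v v) = M *v (Y *v v) + c *s (M *v v)"
    and eq: "weight D k = weight D l + c"
  shows "F k *v (M *v v) = M *v (F l *v v)"
proof -
  have v: "w = (\<Sum>j\<le>D. F j *v w)" for w
    using F by (simp add: spectral_family_def)
  have "F k *v (M *v v) = (\<Sum>j\<le>D. F k *v (M *v (F j *v v)))"
    by (subst v[of v]) (simp add: matrix_vector_mult_sum)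
  also have "\<dots> = (\<Sum>j\<le>D. if j = l then F k *v (M *v (F l *v v)) else 0)"
    using eq by (intro sum.cong) (auto intro!: spectral_shift_zero[OF F k _ M])
  \<comment> \<open>Both sums reduce to the same term; the new index prepares the expansion of the
    result of \<open>M\<close>.\<close>
  also have "\<dots> = (\<Sum>j\<le>D. if j = k then F k *v (M *v (F l *v v)) else 0)"
    using k l by simp
  also have "\<dots> = (\<Sum>j\<le>D. F j *v (M *v (F l *v v)))"
    using eq by (intro sum.cong) (auto intro!: spectral_shift_zero[OF F _ l M] simp flip: eq)
  also have "\<dots> = M *v (F l *v v)" using v by simp
  finally show ?thesis .
qed

lemma spectral_eigenvector_component:
  assumes F: "spectral_family D Y F" and k: "k \<le> D"
    and w: "Y *v w = c *s w" and neq: "c \<noteq> weight D k"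
  shows "F k *v w = 0"
proof -
  have "weight D k *s (F k *v w) = F k *v (Y *v w)"
    using F k by (simp add: spectral_family_def)
  also have "\<dots> = c *s (F k *v w)" by (simp add: w vector_scalar_commute)
  finally show ?thesis using neq by simp
qed

text \<open>Applying \<open>F (r + i)\<close> to a linear relation isolates its \<open>i\<close>-th
  term.\<close>

lemma spectral_independent:
  assumes F: "spectral_family D Y F"
    and le: "r + d \<le> D" and nz: "\<And>j. j \<le> d \<Longrightarrow> F (r + j) *v u \<noteq> 0"
  shows "inj_on (\<lambda>j. F (r + j) *v u) {0..d} \<and>
         vec.independent ((\<lambda>j. F (r + j) *v u) ` {0..d})"
proof
  let ?v = "\<lambda>j. F (r + j) *v u"
  have proj: "F (r + i) *v ?v j = (if i = j then ?v i else 0)" if "i \<le> d" "j \<le> d" for i j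
    using le that by (subst spectral_mult[OF F]) auto
  show inj: "inj_on ?v {0..d}"
  proof (rule inj_onI)
    fix i j assume "i \<in> {0..d}" "j \<in> {0..d}" "?v i = ?v j"
    then show "i = j" using proj[of i i] proj[of i j] nz[of i] by (auto split: if_splits)
  qed
  show "vec.independent (?v ` {0..d})"
  proof (rule vec.independent_if_scalars_zero)
    fix f x assume s: "(\<Sum>x\<in>?v ` {0..d}. f x *s x) = 0" and "x \<in> ?v ` {0..d}"
    then obtain i where i: "i \<le> d" "x = ?v i" by auto
    have "0 = F (r + i) *v (\<Sum>j\<in>{0..d}. f (?v j) *s ?v j)"
      using s by (simp add: sum.reindex[OF inj])
    also have "\<dots> = (\<Sum>j\<in>{0..d}. if j = i then f x *s x else 0)"
      unfolding matrix_vector_mult_sum vector_scalar_commute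
      using i by (intro sum.cong) (auto simp: proj)
    also have "\<dots> = f x *s x" using i by simp
    finally show "f x = 0" using nz[OF i(1)] i by simp
  qed simp
qed

lemma represents_B_mat_sum:
  assumes j: "j \<le> d"
  shows "(\<Sum>i=0..d. B_mat d i j *s v i) =
     (if 0 < j then (\<i> * (of_nat d - of_nat j + 1)) *s v (j - 1) else 0) +
     (if j < d then (- \<i> * (of_nat j + 1)) *s v (j + 1) else 0)"
proof -
  \<comment> \<open>The guard \<open>0 < j\<close> matters: in natural numbers \<open>j - 1\<close>
    is \<open>0\<close> at \<open>j = 0\<close>.\<close>
  have "(\<Sum>i=0..d. B_mat d i j *s v i) =
    (\<Sum>i=0..d. (if i = j - 1 then (if 0 < j then (\<i> * (of_nat d - of_nat j + 1)) *s v (j - 1) else 0) else 0)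
      + (if i = j + 1 then (- \<i> * (of_nat j + 1)) *s v (j + 1) else 0))"
    by (intro sum.cong) (auto simp: B_mat_def)
  also have "\<dots> = (if 0 < j then (\<i> * (of_nat d - of_nat j + 1)) *s v (j - 1) else 0) +
     (if j < d then (- \<i> * (of_nat j + 1)) *s v (j + 1) else 0)"
    using j by (subst sum.distrib) auto
  finally show ?thesis .
qed

section \<open>Spectral projections as Lagrange polynomials\<close>

definition lagrange :: "nat \<Rightarrow> 'n::finite cmat \<Rightarrow> nat \<Rightarrow> 'n cmat" where
  "lagrange D M i = foldr (**)
     (map (\<lambda>j. mat_scale (1 / (weight D i - weight D j)) (M - mat_scale (weight D j) (mat 1)))
        (filter (\<lambda>j. j \<noteq> i) [0..<Suc D]))
     (mat 1)"

lemma lagrange_factor_mult_vec: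
  "mat_scale c (M - mat_scale a (mat 1)) *v v = c *s (M *v v - a *s v)"
  by (simp add: mat_scale_mult_vec matrix_vector_mult_diff_rdistrib)

lemma foldr_mult_vec:
  fixes g :: "'a \<Rightarrow> 'n::finite cmat"
  shows "foldr (**) (map g xs) (mat 1) *v v = foldr (\<lambda>j w. g j *v w) xs v"
  by (induction xs) (simp_all flip: matrix_vector_mul_assoc)

text \<open>Each factor acts on an eigenvector as a scalar, so the product acts by the value of the
  \<open>i\<close>-th Lagrange basis polynomial at \<open>weight D l\<close>.\<close>

lemma lagrange_eigenvector:
  assumes w: "M *v w = weight D l *s w" and l: "l \<le> D"
  shows "lagrange D M i *v w = (if l = i then w else 0)"
proof -
  have factor: "mat_scale (1 / a) (M - mat_scale b (mat 1)) *v (c *s w) =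
      ((weight D l - b) / a * c) *s w" for a b c
    unfolding lagrange_factor_mult_vec vector_scalar_commute w
    by (simp add: vec_eq_iff) (simp add: diff_divide_distrib algebra_simps)
  have "foldr (\<lambda>j w. mat_scale (1 / (weight D i - weight D j)) (M - mat_scale (weight D j) (mat 1)) *v w) xs w
      = (\<Prod>j\<leftarrow>xs. (weight D l - weight D j) / (weight D i - weight D j)) *s w" for xs
    by (induction xs) (simp_all add: factor del: vec.scale_left_diff_distrib)
  then have "lagrange D M i *v w =
      (\<Prod>j\<leftarrow>filter (\<lambda>j. j \<noteq> i) [0..<Suc D]. (weight D l - weight D j) / (weight D i - weight D j)) *s w"
    unfolding lagrange_def foldr_mult_vec .
  moreover have "(\<Prod>j\<leftarrow>filter (\<lambda>j. j \<noteq> i) [0..<Suc D]. (weight D l - weight D j) / (weight D i - weight D j)) =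
      (if l = i then 1 else 0)"
  proof (cases "l = i")
    case True
    have "(\<Prod>j\<leftarrow>filter (\<lambda>j. j \<noteq> i) xs. (weight D i - weight D j) / (weight D i - weight D j)) = 1" for xs
      by (induction xs) auto
    then show ?thesis using True by (simp del: upt_Suc)
  next
    case False
    \<comment> \<open>Since \<open>l \<le> D\<close>, the factor with \<open>j = l\<close> occurs in
      the list and vanishes.\<close>
    then show ?thesis using l by (auto simp: prod_list_zero_iff simp del: upt_Suc)
  qed
  ultimately show ?thesis by simp
qed

text \<open>The eigenvectors \<open>F k *v v\<close> sum to \<open>v\<close>, so checking them
  suffices. Hence \<open>Y\<close> determines its spectral family up to index \<open>D\<close>,
  which later identifies \<open>idem_E\<close>.\<close>

lemma lagrange_spectral:
  assumes F: "spectral_family D Y F" and i: "i \<le> D"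
  shows "lagrange D Y i = F i"
proof -
  have "lagrange D Y i *v v = F i *v v" for v
  proof -
    have "lagrange D Y i *v v = (\<Sum>k\<le>D. lagrange D Y i *v (F k *v v))"
      by (simp only: spectral_familyD(1)[OF F] flip: matrix_vector_mult_sum)
    also have "\<dots> = (\<Sum>k\<le>D. if k = i then F i *v v else 0)"
      by (intro sum.cong) (auto simp: lagrange_eigenvector[OF spectral_familyD(2)[OF F]])
    also have "\<dots> = F i *v v" using i by simp
    finally show ?thesis .
  qed
  then show ?thesis by (simp add: matrix_eq)
qed

text \<open>By \<open>lagrange_spectral\<close>, each \<open>F k\<close> is a polynomial in
  \<open>Y\<close>.\<close>

lemma spectral_family_invariant:
  assumes F: "spectral_family D Y F" and W: "vec.subspace W" "invariant_under W Y"
    and k: "k \<le> D"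
  shows "invariant_under W (F k)"
proof -
  have foldr_mem: "foldr (\<lambda>j w. mat_scale (c j) (Y - mat_scale (a j) (mat 1)) *v w) xs w \<in> W"
    if "w \<in> W" for xs c a w
    using that W
    by (induction xs)
      (auto simp: lagrange_factor_mult_vec invariant_under_def
        intro!: vec.subspace_scale vec.subspace_diff)
  show ?thesis
    unfolding invariant_under_def lagrange_spectral[OF F k, symmetric] lagrange_def foldr_mult_vec
    by (intro ballI foldr_mem)
qed

lemma spectral_family_conjugate:
  fixes Q Q' Y Y' :: "'n::finite cmat"
  assumes F: "spectral_family D Y F" and Q: "Q' ** Q = mat 1" "Q ** Q' = mat 1"
    and Y': "Q ** Y' = Y ** Q"
  shows "spectral_family D Y' (\<lambda>k. Q' ** F k ** Q)"
proof -
  have Qv: "Q' *v (Q *v v) = v" "Q *v (Q' *v v) = v" for v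
    using Q by (simp_all add: matrix_vector_mul_assoc)
  have QY: "Q *v (Y' *v v) = Y *v (Q *v v)" for v
    using Y' by (simp add: matrix_vector_mul_assoc)
  have Y'Q: "Y' *v (Q' *v v) = Q' *v (Y *v v)" for v
    by (metis Qv QY)
  have Fv: "(Q' ** F k ** Q) *v v = Q' *v (F k *v (Q *v v))" for k v
    by (simp flip: matrix_vector_mul_assoc)
  show ?thesis
    unfolding spectral_family_def Fv
    by (simp add: Y'Q QY spectral_familyD[OF F] vector_scalar_commute Qv
        flip: matrix_vector_mult_sum)
qed

lemma spectral_supportE:
  assumes "k \<in> spectral_support D F W" and "vec.subspace W"
  obtains x where "k \<le> D" "x \<in> W" "F k *v x \<noteq> 0"
proof -
  have "0 \<in> (*v) (F k) ` W" using vec.subspace_0[OF assms(2)] by (auto intro: image_eqI[of _ _ 0])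
  moreover have "k \<le> D" "(*v) (F k) ` W \<noteq> {0}" using assms(1) by (auto simp: spectral_support_def)
  ultimately have "\<exists>x\<in>W. F k *v x \<noteq> 0" by blast
  then show thesis using that \<open>k \<le> D\<close> by blast
qed

section \<open>Cyclic triples\<close>

text \<open>One cyclic shift of the theorem: \<open>E\<close> supplies the eigenvector,
  \<open>F\<close> its components, and \<open>Z\<close> is the matrix to be represented.
  Irreducibility is phrased through the three matrices alone, hence is symmetric under
  rotation.\<close>

locale irreducible_triple =
  fixes X Y Z :: "'n::finite cmat" and E F :: "nat \<Rightarrow> 'n cmat" and D :: nat
    and W :: "'n cvec set"
  assumes triple: "cyclic_triple X Y Z"
    and E: "spectral_family D X E" and F: "spectral_family D Y F"
    and W: "vec.subspace W" "invariant_under W X" "invariant_under W Y" "invariant_under W Z"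
    and irreducible: "\<And>U. \<lbrakk>vec.subspace U; U \<subseteq> W; invariant_under U X; invariant_under U Y;
        invariant_under U Z\<rbrakk> \<Longrightarrow> U = {0} \<or> U = W"
begin

lemma E_invariant: "k \<le> D \<Longrightarrow> invariant_under W (E k)"
  by (rule spectral_family_invariant[OF E W(1,2)])

lemma F_invariant: "k \<le> D \<Longrightarrow> invariant_under W (F k)"
  by (rule spectral_family_invariant[OF F W(1,3)])

text \<open>Minimality of \<open>r\<close> refers to the support for \<open>X\<close>; only for
  \<open>X = dual_A\<close> is this the definition of the endpoint.\<close>

context
  fixes r :: nat and u :: "'n cvec"
  assumes r: "r \<in> spectral_support D E W" "\<And>k. k < r \<Longrightarrow> k \<notin> spectral_support D E W"
    and u: "u \<in> (*v) (E r) ` W" "u \<noteq> 0"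
begin

lemma r_le: "r \<le> D" using r by (simp add: spectral_support_def)

lemma u_mem: "u \<in> W" using u E_invariant[OF r_le] by (auto simp: invariant_under_def)

lemma X_u: "X *v u = weight D r *s u"
  using u r_le E by (auto simp: spectral_family_def)

lemma commutators:
  "X *v (Y *v v) - Y *v (X *v v) = (2 * \<i>) *s (Z *v v)"
  "Y *v (Z *v v) - Z *v (Y *v v) = (2 * \<i>) *s (X *v v)"
  "Z *v (X *v v) - X *v (Z *v v) = (2 * \<i>) *s (Y *v v)"
  using triple by (simp_all add: cyclic_triple_def)

lemma Z_u: "Z *v u = \<i> *s (Y *v u)"
proof -
  \<comment> \<open>\<open>w\<close> would have the eigenvalue of index \<open>r - 1\<close>, which does not occur in \<open>W\<close>.\<close>
  define w where "w = Y *v u + \<i> *s (Z *v u)"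
  have wW: "w \<in> W" unfolding w_def using W u_mem
    by (auto simp: invariant_under_def intro!: vec.subspace_add vec.subspace_scale)
  have "X *v w = (X *v (Y *v u) - Y *v (X *v u)) + Y *v (X *v u)
     - \<i> *s (Z *v (X *v u) - X *v (Z *v u)) + \<i> *s (Z *v (X *v u))"
    unfolding w_def
    by (simp add: matrix_vector_right_distrib vector_scalar_commute vec.scale_right_diff_distrib)
  also have "\<dots> = (weight D r + 2) *s w"
    unfolding commutators unfolding X_u w_def vector_scalar_commute
    by (simp add: vec_eq_iff) (simp add: algebra_simps)
  finally have Xw: "X *v w = (weight D r + 2) *s w" .
  have "E k *v w = 0" if k: "k \<le> D" for k
  proof (cases "k < r")
    case True
    then show ?thesis using r(2)[OF True] k wW by (auto simp: spectral_support_def)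
  next
    case False
    then have "weight D r + 2 \<noteq> weight D k"
      using weight_shift_neq(1)[of r k D] by auto
    then show ?thesis using spectral_eigenvector_component[OF E k Xw] by blast
  qed
  then have "w = 0" by (rule spectral_eq_0I[OF E])
  \<comment> \<open>Multiplied by \<open>\<i>\<close>, the vanishing of \<open>w\<close> reads
    \<open>\<i> *s (Y *v u) - Z *v u = 0\<close>.\<close>
  then have "\<i> *s w = 0" by simp
  then show ?thesis unfolding w_def by (simp add: vec_eq_iff algebra_simps)
qed

section \<open>Ladder operators for the eigenspaces of \<open>Y\<close>\<close>

definition "R = Z + mat_scale \<i> X"
definition "L = Z + mat_scale (- \<i>) X"

lemma R_apply: "R *v v = Z *v v + \<i> *s (X *v v)"
  by (simp add: R_def matrix_vector_mult_add_rdistrib mat_scale_mult_vec)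

lemma L_apply: "L *v v = Z *v v - \<i> *s (X *v v)"
  by (simp add: L_def matrix_vector_mult_add_rdistrib mat_scale_mult_vec)

text \<open>\<open>R\<close> raises the eigenvalue by 2 and therefore lowers the index by one, as
  the eigenvalue is \<open>D - 2 * k\<close>; \<open>L\<close> does the opposite.\<close>

lemma Y_R: "Y *v (R *v v) = R *v (Y *v v) + 2 *s (R *v v)"
proof -
  have "Y *v (R *v v) - R *v (Y *v v) =
    (Y *v (Z *v v) - Z *v (Y *v v)) - \<i> *s (X *v (Y *v v) - Y *v (X *v v))"
    by (simp add: R_apply matrix_vector_right_distrib vector_scalar_commute
        vec.scale_right_diff_distrib)
  also have "\<dots> = 2 *s (R *v v)"
    unfolding commutators R_apply by (simp add: vec_eq_iff algebra_simps)
  finally show ?thesis by (simp add: algebra_simps)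
qed

lemma Y_L: "Y *v (L *v v) = L *v (Y *v v) + (- 2) *s (L *v v)"
proof -
  have "Y *v (L *v v) - L *v (Y *v v) =
    (Y *v (Z *v v) - Z *v (Y *v v)) + \<i> *s (X *v (Y *v v) - Y *v (X *v v))"
    by (simp add: L_apply matrix_vector_mult_diff_distrib vector_scalar_commute
        vec.scale_right_diff_distrib)
  also have "\<dots> = (- 2) *s (L *v v)"
    unfolding commutators L_apply by (simp add: vec_eq_iff algebra_simps)
  finally show ?thesis by (simp add: algebra_simps)
qed

abbreviation "w k \<equiv> F k *v u"

text \<open>By \<open>Z_u\<close> and \<open>X_u\<close>, \<open>R *v u\<close> is
  \<open>\<i>\<close> times \<open>Y *v u + weight D r *s u\<close>, and under \<open>F k\<close>
  the matrix \<open>Y\<close> becomes the scalar \<open>weight D k\<close>.\<close>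

lemma F_R_u:
  assumes "k \<le> D"
  shows "F k *v (R *v u) = (2 * \<i> * (of_nat D - of_nat r - of_nat k)) *s w k"
  unfolding R_apply Z_u X_u matrix_vector_right_distrib vector_scalar_commute
    spectral_familyD(3)[OF F assms]
  by (simp add: vec_eq_iff weight_def algebra_simps)

lemma F_L_u:
  assumes "k \<le> D"
  shows "F k *v (L *v u) = (2 * \<i> * (of_nat r - of_nat k)) *s w k"
  unfolding L_apply Z_u X_u matrix_vector_mult_diff_distrib vector_scalar_commute
    spectral_familyD(3)[OF F assms]
  by (simp add: vec_eq_iff weight_def algebra_simps)

text \<open>\<open>F k *v (R *v u)\<close> is computed twice: by moving \<open>R\<close> out of the
  projection, and by \<open>F_R_u\<close>.\<close>

lemma R_w:
  assumes "k < D"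
  shows "R *v w (Suc k) = (2 * \<i> * (of_nat D - of_nat r - of_nat k)) *s w k"
  using spectral_shift[OF F _ _ Y_R, of k "Suc k" u] F_R_u[of k] assms by (simp add: weight_def)

lemma L_w:
  assumes "k < D"
  shows "L *v w k = (2 * \<i> * (of_nat r - of_nat (Suc k))) *s w (Suc k)"
  using spectral_shift[OF F _ _ Y_L, of "Suc k" k u] F_L_u[of "Suc k"] assms by (simp add: weight_def)

text \<open>Index \<open>0\<close> carries the largest weight, so no component is left for the
  raised vector.\<close>

lemma R_w_0: "R *v w 0 = 0"
proof -
  have "F k *v (R *v w 0) = 0" if "k \<le> D" for k
    using that by (intro spectral_shift_zero[OF F that _ Y_R] weight_shift_neq) auto
  then show ?thesis by (rule spectral_eq_0I[OF F])
qed

lemma L_w_D: "L *v w D = 0"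
proof -
  have "F k *v (L *v w D) = 0" if "k \<le> D" for k
    using that by (intro spectral_shift_zero[OF F that _ Y_L] weight_shift_neq) auto
  then show ?thesis by (rule spectral_eq_0I[OF F])
qed

text \<open>\<open>L\<close> maps nothing into index \<open>0\<close>, so \<open>F_L_u\<close> kills
  \<open>w 0\<close> if \<open>r > 0\<close>. Then \<open>L_w\<close> carries the vanishing upward
  while its scalar is nonzero, that is, below \<open>r\<close>.\<close>

lemma w_below: "k < r \<Longrightarrow> w k = 0"
proof (induction k)
  case 0
  have "F 0 *v (L *v u) = (\<Sum>l\<le>D. F 0 *v (L *v w l))"
    using F by (simp add: spectral_family_def flip: matrix_vector_mult_sum)
  also have "\<dots> = 0"
  proof (rule sum.neutral, safe)
    fix l assume "l \<le> D"
    then show "F 0 *v (L *v w l) = 0"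
      by (intro spectral_shift_zero[OF F _ _ Y_L] weight_shift_neq) auto
  qed
  finally show ?case using F_L_u[of 0] 0 by simp
next
  case (Suc k)
  then show ?case using L_w[of k] r_le by (auto simp flip: of_nat_Suc)
qed

text \<open>The mirror image of \<open>w_below\<close>: \<open>R\<close> maps nothing into index
  \<open>D\<close>, and \<open>R_w\<close> carries the vanishing downward.\<close>

lemma w_above:
  assumes "D - r < k" "k \<le> D" shows "w k = 0"
  using assms(2,1)
proof (induction k rule: inc_induct)
  case base
  have "F D *v (R *v u) = (\<Sum>l\<le>D. F D *v (R *v w l))"
    using F by (simp add: spectral_family_def flip: matrix_vector_mult_sum)
  also have "\<dots> = 0"
  proof (rule sum.neutral, safe)
    fix l assume l: "l \<le> D"
    then show "F D *v (R *v w l) = 0"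
      by (intro spectral_shift_zero[OF F _ _ Y_R] weight_shift_neq) auto
  qed
  finally show ?case using F_R_u[of D] base by auto
next
  case (step k)
  have "(of_nat D - of_nat r - of_nat k :: complex) \<noteq> 0"
  proof
    assume "(of_nat D - of_nat r - of_nat k :: complex) = 0"
    then have "(of_nat D :: complex) = of_nat (r + k)" by (simp add: algebra_simps)
    then show False using step by (simp only: of_nat_eq_iff)
  qed
  then show ?case using R_w[of k] step by auto
qed

text \<open>From a zero at such a \<open>k\<close>, \<open>L_w\<close> propagates zeros upward and
  \<open>R_w\<close> downward, with nonzero scalars throughout, so \<open>u\<close> would be
  zero.\<close>

lemma w_nonzero:
  assumes k: "r \<le> k" "k \<le> D - r" shows "w k \<noteq> 0"
proof
  assume z: "w k = 0"
  have up: "w l = 0" if "k \<le> l" "l \<le> D" for l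
    using that
  proof (induction l rule: dec_induct)
    case (step l)
    have "(of_nat r - of_nat (Suc l) :: complex) \<noteq> 0"
      using step k by (simp only: right_minus_eq of_nat_eq_iff)
    then show ?case using L_w[of l] step by auto
  qed (rule z)
  have down: "w l = 0" if "l \<le> k" for l
    using that
  proof (induction l rule: inc_induct)
    case (step l)
    have "(of_nat D - of_nat r - of_nat l :: complex) = of_nat (D - r - l)"
      using step k r_le by (simp add: of_nat_diff)
    also have "\<dots> \<noteq> 0" using step k by (simp only: of_nat_eq_0_iff)
    finally show ?case using R_w[of l] step k by auto
  qed (rule z)
  have "w l = 0" if "l \<le> D" for l using up down that nle_le by blast
  then show False using spectral_eq_0I[OF F] u by blast
qed

text \<open>Otherwise the ranges of \<open>w_below\<close> and \<open>w_above\<close> cover all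
  indices.\<close>

lemma twice_r_le: "2 * r \<le> D"
proof (rule ccontr)
  assume "\<not> 2 * r \<le> D"
  have "w l = 0" if "l \<le> D" for l
  proof -
    have "l < r \<or> D - r < l" using \<open>\<not> 2 * r \<le> D\<close> by linarith
    then show ?thesis using w_below w_above that by blast
  qed
  then show False using spectral_eq_0I[OF F] u by blast
qed

lemma Z_w:
  assumes j: "j \<le> D - 2 * r"
  shows "Z *v w (r + j) = (\<Sum>i=0..D - 2 * r. B_mat (D - 2 * r) i j *s w (r + i))"
proof -
  let ?d = "D - 2 * r"
  have d: "(of_nat ?d :: complex) = of_nat D - 2 * of_nat r"
    using twice_r_le by (simp add: of_nat_diff)
  have R: "R *v w (r + j) =
      (if 0 < j then (2 * \<i> * (of_nat ?d - of_nat j + 1)) *s w (r + (j - 1)) else 0)"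
  proof (cases j)
    \<comment> \<open>The index \<open>r - 1\<close> either does not exist or carries the zero
      component.\<close>
    case 0
    show ?thesis
    proof (cases r)
      case (Suc r')
      then show ?thesis using R_w[of r'] w_below[of r'] r_le 0 by simp
    qed (simp add: 0 R_w_0)
  next
    case (Suc j')
    then show ?thesis using R_w[of "r + j'"] j d by (simp add: algebra_simps)
  qed
  have L: "L *v w (r + j) =
      (if j < ?d then (- 2 * \<i> * (of_nat j + 1)) *s w (r + (j + 1)) else 0)"
  proof (cases "r + j = D")
    case True
    then show ?thesis using L_w_D j by auto
  next
    case False
    then have lt: "r + j < D" using j twice_r_le by linarith
    show ?thesis
    proof (cases "j < ?d")
      case True
      then show ?thesis using L_w[OF lt] by (simp add: algebra_simps)
    next
      case False
      \<comment> \<open>Here \<open>j\<close> is the last index, and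
        \<open>r + j + 1 = D - r + 1\<close> lies above the range.\<close>
      then have "w (Suc (r + j)) = 0" using lt j by (intro w_above) auto
      then show ?thesis using L_w[OF lt] False by simp
    qed
  qed
  have "2 *s (Z *v w (r + j)) = R *v w (r + j) + L *v w (r + j)"
    by (simp add: R_apply L_apply vec_eq_iff)
  also have "\<dots> = 2 *s (\<Sum>i=0..?d. B_mat ?d i j *s w (r + i))"
    unfolding represents_B_mat_sum[OF j] R L by (simp add: vec_eq_iff algebra_simps)
  finally show ?thesis by (simp add: vec_eq_iff)
qed

text \<open>The span is invariant under \<open>Y\<close> (eigenvectors), under \<open>Z\<close> (by
  \<open>Z_w\<close>), and hence under \<open>X\<close>, a multiple of their commutator. It is
  nonzero, so irreducibility applies.\<close>

lemma span_w: "vec.span ((\<lambda>j. w (r + j)) ` {0..D - 2 * r}) = W"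
proof -
  let ?S = "(\<lambda>j. w (r + j)) ` {0..D - 2 * r}"
  let ?U = "vec.span ?S"
  have ge: "r + j \<le> D" if "j \<le> D - 2 * r" for j using that twice_r_le by linarith
  have mem: "w (r + j) \<in> ?U" if "j \<le> D - 2 * r" for j
    using that by (intro vec.span_base image_eqI[of _ _ j]) auto
  have sub: "?U \<subseteq> W"
  proof (rule vec.span_minimal[OF _ W(1)])
    show "?S \<subseteq> W" using F_invariant u_mem ge by (auto simp: invariant_under_def)
  qed
  have gen: "invariant_under ?U M" if "\<And>x. x \<in> ?S \<Longrightarrow> M *v x \<in> ?U" for M
    unfolding invariant_under_def
  proof
    fix x assume "x \<in> ?U"
    then show "M *v x \<in> ?U"
    proof (induction rule: vec.span_induct_alt)
      case (step c x y)
      then show ?case using that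
        by (simp add: matrix_vector_right_distrib vector_scalar_commute vec.span_add vec.span_scale)
    qed (simp add: vec.span_zero)
  qed
  have UY: "invariant_under ?U Y"
    by (rule gen) (auto simp: spectral_familyD(2)[OF F] ge mem intro!: vec.span_scale)
  have UZ: "invariant_under ?U Z"
    by (rule gen) (auto simp: Z_w mem intro!: vec.span_sum vec.span_scale)
  have UX: "invariant_under ?U X"
    unfolding invariant_under_def
  proof
    fix x assume x: "x \<in> ?U"
    have "X *v x = (1 / (2 * \<i>)) *s (Y *v (Z *v x) - Z *v (Y *v x))"
      by (simp add: commutators vector_smult_assoc)
    also have "\<dots> \<in> ?U"
      using UY UZ x by (auto simp: invariant_under_def intro!: vec.span_scale vec.span_diff)
    finally show "X *v x \<in> ?U" .
  qed
  have "w r \<in> ?U" using mem[of 0] by simp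
  moreover have "w r \<noteq> 0" using w_nonzero twice_r_le by simp
  ultimately have "?U \<noteq> {0}" by blast
  then show ?thesis using irreducible[OF vec.subspace_span sub UX UY UZ] by blast
qed

lemma represents_Z: "represents (D - 2 * r) (B_mat (D - 2 * r)) Z (\<lambda>j. F (r + j) *v u) W"
proof -
  have "is_basis (D - 2 * r) (\<lambda>j. F (r + j) *v u) W"
    using spectral_independent[OF F, of r "D - 2 * r" u] w_nonzero twice_r_le span_w
    by (auto simp: is_basis_def)
  then show ?thesis by (auto simp: represents_def Z_w)
qed

text \<open>\<open>W\<close> is spanned by the \<open>w k\<close> with \<open>k\<close> in this
  interval, and the other projections kill them all.\<close>

lemma support_F: "spectral_support D F W = {r..D - r}"
proof (intro set_eqI iffI)
  fix k assume "k \<in> {r..D - r}"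
  then show "k \<in> spectral_support D F W"
    using w_nonzero[of k] u_mem by (auto simp: spectral_support_def)
next
  fix k assume "k \<in> spectral_support D F W"
  then obtain x where k: "k \<le> D" and x: "x \<in> W" "F k *v x \<noteq> 0"
    using spectral_supportE[OF _ W(1)] by blast
  show "k \<in> {r..D - r}"
  proof (rule ccontr)
    assume out: "k \<notin> {r..D - r}"
    have "x \<in> vec.span ((\<lambda>j. w (r + j)) ` {0..D - 2 * r})" using x span_w by simp
    then have "F k *v x = 0"
    proof (induction rule: vec.span_induct_alt)
      case (step c x y)
      then obtain j where j: "j \<le> D - 2 * r" "x = w (r + j)" by auto
      then have "F k *v x = 0"
        using out k twice_r_le by (subst j(2), subst spectral_mult[OF F]) auto
      then show ?case using step by (simp add: matrix_vector_right_distrib vector_scalar_commute)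
    qed simp
    then show False using x by simp
  qed
qed

end

text \<open>Passes from the support for \<open>X\<close> to that for \<open>Y\<close>; going round
  the cycle compares all three supports.\<close>

lemma support_F_from_support_E:
  assumes "W \<noteq> {0}"
  obtains r where "2 * r \<le> D" "r \<in> spectral_support D E W"
    "\<And>k. k < r \<Longrightarrow> k \<notin> spectral_support D E W" "spectral_support D F W = {r..D - r}"
proof -
  obtain x where x: "x \<in> W" "x \<noteq> 0" using assms vec.subspace_0[OF W(1)] by blast
  have "\<exists>k. k \<in> spectral_support D E W"
  proof (rule ccontr)
    assume "\<nexists>k. k \<in> spectral_support D E W"
    then have "E k *v x = 0" if "k \<le> D" for k using that x by (auto simp: spectral_support_def)
    then have "(\<Sum>k\<le>D. E k *v x) = 0" by simp
    then show False using E x by (simp add: spectral_family_def)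
  qed
  define r where "r = (LEAST k. k \<in> spectral_support D E W)"
  have r: "r \<in> spectral_support D E W" "\<And>k. k < r \<Longrightarrow> k \<notin> spectral_support D E W"
    using \<open>\<exists>k. k \<in> spectral_support D E W\<close> unfolding r_def by (auto intro: LeastI dest: not_less_Least)
  then obtain y where "y \<in> W" "E r *v y \<noteq> 0"
    using spectral_supportE[OF _ W(1)] by blast
  then have u: "E r *v y \<in> (*v) (E r) ` W" "E r *v y \<noteq> 0" by simp_all
  show thesis using that[OF twice_r_le[OF r u] r support_F[OF r u]] .
qed

end

section \<open>The hypercube\<close>

definition flip :: "'n \<Rightarrow> 'n::finite vert \<Rightarrow> 'n vert" where
  "flip k y = (\<chi> i. if i = k then \<not> y $ i else y $ i)"

text \<open>The sign \<open>(-1)^(y_k)\<close>. With \<open>flip\<close> it writes the three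
  matrices as sums over the coordinates of Pauli matrices, up to sign.\<close>

definition spin :: "'n::finite vert \<Rightarrow> 'n \<Rightarrow> complex" where
  "spin y k = (if y $ k then - 1 else 1)"

lemma flip_nth [simp]: "flip k y $ i = (if i = k then \<not> y $ i else y $ i)"
  by (simp add: flip_def)

lemma flip_flip [simp]: "flip k (flip k y) = y"
  by (simp add: vec_eq_iff)

lemma flip_commute: "flip k (flip l y) = flip l (flip k y)"
  by (simp add: vec_eq_iff)

lemma inj_flip: "inj (\<lambda>k. flip k y)"
  by (rule injI) (metis flip_nth)

lemma spin_square [simp]: "spin y k * spin y k = 1"
  by (simp add: spin_def)

lemma spin_flip: "spin (flip k y) l = (if l = k then - spin y l else spin y l)"
  by (simp add: spin_def)

lemma sum_spin_flip: "sum (spin (flip k y)) UNIV = sum (spin y) UNIV - 2 * spin y k"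
proof -
  have "sum (spin (flip k y)) UNIV = (\<Sum>l\<in>UNIV. spin y l - (if l = k then 2 * spin y k else 0))"
    by (intro sum.cong) (auto simp: spin_flip)
  then show ?thesis by (simp add: sum_subtractf)
qed

lemma cube_adj_iff_flip: "cube_adj y z \<longleftrightarrow> (\<exists>k. z = flip k y)"
proof
  assume "cube_adj y z"
  then obtain k where k: "{k. y $ k \<noteq> z $ k} = {k}"
    by (auto simp: cube_adj_def card_1_singleton_iff)
  have "y $ i \<noteq> z $ i \<longleftrightarrow> i = k" for i using k by auto
  then have "z = flip k y" by (auto simp: vec_eq_iff)
  then show "\<exists>k. z = flip k y" ..
next
  assume "\<exists>k. z = flip k y"
  then obtain k where "z = flip k y" ..
  then have "{k. y $ k \<noteq> z $ k} = {k}" by auto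
  then show "cube_adj y z" by (simp add: cube_adj_def)
qed

text \<open>An edge creates at most one new disagreement, and a disagreement can always be removed
  along an edge.\<close>

lemma cube_dist_eq_card: "cube_dist y z = card {k. y $ k \<noteq> z $ k}"
proof -
  let ?R = "{(a, b). cube_adj a b}"
  have lower: "card {k. y $ k \<noteq> z $ k} \<le> l" if "(y, z) \<in> ?R ^^ l" for l z
    using that
  proof (induction l arbitrary: z)
    case (Suc l)
    then obtain x where x: "(y, x) \<in> ?R ^^ l" "cube_adj x z" by auto
    then obtain m where m: "z = flip m x" by (auto simp: cube_adj_iff_flip)
    have "card {k. y $ k \<noteq> z $ k} \<le> card (insert m {k. y $ k \<noteq> x $ k})"
      by (rule card_mono) (auto simp: m)
    also have "\<dots> \<le> Suc l" using Suc.IH[OF x(1)] by (simp add: card_insert_if)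
    finally show ?case .
  qed auto
  have upper: "(y, z) \<in> ?R ^^ n" if "card {k. y $ k \<noteq> z $ k} = n" for n
    using that
  proof (induction n arbitrary: z)
    case 0
    then show ?case by (simp add: vec_eq_iff)
  next
    case (Suc n)
    then obtain m where m: "y $ m \<noteq> z $ m" by (fastforce simp: card_Suc_eq)
    have "{k. y $ k \<noteq> flip m z $ k} = {k. y $ k \<noteq> z $ k} - {m}" using m by auto
    then have "(y, flip m z) \<in> ?R ^^ n" using Suc m by (intro Suc.IH) simp
    moreover have "(flip m z, z) \<in> ?R" by (auto simp: cube_adj_iff_flip intro: exI[of _ m])
    ultimately show ?case by auto
  qed
  show ?thesis unfolding cube_dist_def by (rule Least_equality, rule upper[OF refl], erule lower)
qed

lemma theta_eq_weight: "theta TYPE('n::finite) i = weight CARD('n) i"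
  by (simp add: theta_def weight_def)

lemma theta_cube_dist:
  fixes y :: "'n::finite vert"
  shows "theta TYPE('n) (cube_dist base_vertex y) = sum (spin y) UNIV"
proof -
  have "sum (spin y) UNIV = (\<Sum>k\<in>UNIV. 1 - 2 * (if y $ k then 1 else 0))"
    by (intro sum.cong) (auto simp: spin_def)
  also have "\<dots> = of_nat CARD('n) - 2 * (\<Sum>k\<in>UNIV. if y $ k then 1 else 0)"
    by (simp add: sum_subtractf flip: sum_distrib_left)
  also have "(\<Sum>k\<in>UNIV. if y $ k then 1 else (0::complex)) = of_nat (card {k. y $ k})"
    by (simp flip: sum.inter_filter)
  finally show ?thesis by (simp add: theta_def cube_dist_eq_card base_vertex_def)
qed

lemma adj_A_apply: "(adj_A *v v) $ y = (\<Sum>k\<in>UNIV. v $ flip k y)"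
proof -
  have "(adj_A *v v) $ y = (\<Sum>z\<in>UNIV. if z \<in> range (\<lambda>k. flip k y) then v $ z else 0)"
    by (auto simp: adj_A_def matrix_vector_mult_def cube_adj_iff_flip intro!: sum.cong)
  also have "\<dots> = (\<Sum>z\<in>range (\<lambda>k. flip k y). v $ z)"
    by (simp add: sum.If_cases)
  also have "\<dots> = (\<Sum>k\<in>UNIV. v $ flip k y)"
    by (simp add: sum.reindex[OF inj_flip])
  finally show ?thesis .
qed

lemma dual_A_apply: "(dual_A *v v) $ y = sum (spin y) UNIV * v $ y"
proof -
  have "(dual_A *v v) $ y = (\<Sum>z\<in>UNIV. if z = y then sum (spin y) UNIV * v $ y else 0)"
    by (simp only: dual_A_def matrix_vector_mult_def vec_lambda_beta)
      (intro sum.cong, auto simp: theta_cube_dist)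
  then show ?thesis by simp
qed

lemma eps_A_mult_vec:
  "eps_A *v v = (- \<i> / 2) *s (adj_A *v (dual_A *v v) - dual_A *v (adj_A *v v))"
  by (simp only: eps_A_def mat_scale_mult_vec matrix_vector_mult_diff_rdistrib matrix_vector_mul_assoc)

text \<open>Flipping coordinate \<open>k\<close> changes the spin sum by
  \<open>- 2 * spin y k\<close>; the rest of the commutator cancels.\<close>

lemma eps_A_apply: "(eps_A *v v) $ y = \<i> * (\<Sum>k\<in>UNIV. spin y k * v $ flip k y)"
proof -
  have "(eps_A *v v) $ y = (- \<i> / 2) * ((\<Sum>k\<in>UNIV. (sum (spin y) UNIV - 2 * spin y k) * v $ flip k y)
      - sum (spin y) UNIV * (\<Sum>k\<in>UNIV. v $ flip k y))"
    by (simp only: eps_A_mult_vec vector_smult_component vector_minus_component adj_A_apply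
        dual_A_apply sum_spin_flip)
  also have "(\<Sum>k\<in>UNIV. (sum (spin y) UNIV - 2 * spin y k) * v $ flip k y) =
      sum (spin y) UNIV * (\<Sum>k\<in>UNIV. v $ flip k y) - 2 * (\<Sum>k\<in>UNIV. spin y k * v $ flip k y)"
    by (simp add: left_diff_distrib sum_subtractf sum_distrib_left mult.assoc)
  finally show ?thesis by simp
qed

lemma cyclic_triple_cube: "cyclic_triple adj_A dual_A (eps_A :: 'n::finite cmat)"
  unfolding cyclic_triple_def
proof (intro conjI allI)
  fix v :: "'n cvec"
  show "adj_A *v (dual_A *v v) - dual_A *v (adj_A *v v) = (2 * \<i>) *s (eps_A *v v)"
    by (simp add: eps_A_mult_vec vec_eq_iff)
  have "(dual_A *v (eps_A *v v) - eps_A *v (dual_A *v v)) $ y = ((2 * \<i>) *s (adj_A *v v)) $ y" for y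
  proof -
    have "spin y k * (sum (spin (flip k y)) UNIV * v $ flip k y) =
        sum (spin y) UNIV * (spin y k * v $ flip k y) - 2 * v $ flip k y" for k
    proof -
      have "spin y k * (sum (spin (flip k y)) UNIV * v $ flip k y) =
          sum (spin y) UNIV * (spin y k * v $ flip k y) - 2 * (spin y k * spin y k) * v $ flip k y"
        unfolding sum_spin_flip by (simp only: algebra_simps)
      then show ?thesis by simp
    qed
    then have "(\<Sum>k\<in>UNIV. spin y k * (sum (spin (flip k y)) UNIV * v $ flip k y)) =
        sum (spin y) UNIV * (\<Sum>k\<in>UNIV. spin y k * v $ flip k y) - 2 * (\<Sum>k\<in>UNIV. v $ flip k y)"
      by (simp add: sum_subtractf sum_distrib_left)
    then show ?thesis
      by (simp add: eps_A_apply dual_A_apply adj_A_apply right_diff_distrib)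
  qed
  then show "dual_A *v (eps_A *v v) - eps_A *v (dual_A *v v) = (2 * \<i>) *s (adj_A *v v)"
    unfolding vec_eq_iff by blast
  have "(eps_A *v (adj_A *v v) - adj_A *v (eps_A *v v)) $ y = ((2 * \<i>) *s (dual_A *v v)) $ y" for y
  proof -
    have "(eps_A *v (adj_A *v v)) $ y = \<i> * (\<Sum>k\<in>UNIV. \<Sum>l\<in>UNIV. spin y k * v $ flip l (flip k y))"
      by (simp add: eps_A_apply adj_A_apply sum_distrib_left)
    moreover have "(adj_A *v (eps_A *v v)) $ y =
        \<i> * (\<Sum>l\<in>UNIV. \<Sum>k\<in>UNIV. spin (flip l y) k * v $ flip k (flip l y))"
      by (simp add: eps_A_apply adj_A_apply sum_distrib_left)
    \<comment> \<open>Flips commute, so the two double sums differ only where \<open>k = l\<close>: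
      there the spin changes sign and the double flip returns to \<open>y\<close>.\<close>
    moreover have "(\<Sum>l\<in>UNIV. \<Sum>k\<in>UNIV. spin (flip l y) k * v $ flip k (flip l y)) =
        (\<Sum>k\<in>UNIV. \<Sum>l\<in>UNIV. spin y k * v $ flip l (flip k y) - (if l = k then 2 * spin y k * v $ y else 0))"
      by (subst sum.swap, intro sum.cong) (auto simp: spin_flip flip_commute)
    ultimately show ?thesis
      by (simp add: dual_A_apply sum_subtractf right_diff_distrib mult.assoc
          flip: sum_distrib_left sum_distrib_right)
  qed
  then show "eps_A *v (adj_A *v v) - adj_A *v (eps_A *v v) = (2 * \<i>) *s (dual_A *v v)"
    unfolding vec_eq_iff by blast
qed

section \<open>The matrix \<open>P\<close> and its intertwining relations\<close>

lemma P_mat_flip_right: "P_mat $ y $ flip k z = spin y k * P_mat $ y $ z"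
proof -
  have "(\<Prod>i\<in>UNIV. P1 (y $ i) (flip k z $ i)) =
      (\<Prod>i\<in>UNIV. (if i = k then spin y k else 1) * P1 (y $ i) (z $ i))"
    by (intro prod.cong) (auto simp: P1_def spin_def)
  then show ?thesis by (simp add: P_mat_def prod.distrib)
qed

lemma P_mat_flip_left: "P_mat $ flip k y $ z = - \<i> * spin y k * spin z k * P_mat $ y $ z"
proof -
  have "(\<Prod>i\<in>UNIV. P1 (flip k y $ i) (z $ i)) =
      (\<Prod>i\<in>UNIV. (if i = k then - \<i> * spin y k * spin z k else 1) * P1 (y $ i) (z $ i))"
    by (intro prod.cong) (auto simp: P1_def spin_def)
  also have "\<dots> = - \<i> * spin y k * spin z k * (\<Prod>i\<in>UNIV. P1 (y $ i) (z $ i))"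
    by (subst prod.distrib) (simp only: prod.delta finite UNIV_I if_True)
  finally show ?thesis by (simp add: P_mat_def)
qed

lemma sum_flip_reindex: "(\<Sum>z\<in>UNIV. f (flip k z)) = (\<Sum>z\<in>UNIV. f z)"
  by (rule sum.reindex_bij_witness[of _ "flip k" "flip k"]) auto

text \<open>Reindexing moves the flip from \<open>v\<close> to the column index of \<open>P\<close>,
  where it becomes the sign \<open>spin y k\<close>; these signs sum to the diagonal entry of
  \<open>dual_A\<close>.\<close>

lemma P_mat_adj_A: "P_mat ** adj_A = dual_A ** (P_mat :: 'n::finite cmat)"
proof -
  have "(P_mat *v (adj_A *v v)) $ y = (dual_A *v (P_mat *v v)) $ y" for v :: "'n cvec" and y
  proof -
    have reindex: "(\<Sum>z\<in>UNIV. P_mat $ y $ z * v $ flip k z) =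
        (\<Sum>z\<in>UNIV. P_mat $ y $ flip k z * v $ z)" for k
      using sum_flip_reindex[of "\<lambda>z. P_mat $ y $ flip k z * v $ z" k] by simp
    have "(P_mat *v (adj_A *v v)) $ y = (\<Sum>k\<in>UNIV. \<Sum>z\<in>UNIV. P_mat $ y $ z * v $ flip k z)"
      by (subst sum.swap)
        (simp add: matrix_vector_mult_def[of P_mat] adj_A_apply sum_distrib_left)
    also have "\<dots> = (\<Sum>k\<in>UNIV. \<Sum>z\<in>UNIV. P_mat $ y $ flip k z * v $ z)"
      by (simp only: reindex)
    also have "\<dots> = (dual_A *v (P_mat *v v)) $ y"
      by (simp add: dual_A_apply matrix_vector_mult_def[of P_mat] P_mat_flip_right mult.assoc
          flip: sum_distrib_left sum_distrib_right)
    finally show ?thesis .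
  qed
  then have "P_mat *v (adj_A *v v) = dual_A *v (P_mat *v v)" for v :: "'n cvec"
    unfolding vec_eq_iff by blast
  then show ?thesis by (simp add: matrix_eq flip: matrix_vector_mul_assoc)
qed

text \<open>After reindexing, the factors \<open>spin y k\<close> and
  \<open>- \<i> * spin z k\<close> combine to exactly the effect of a flip in the row index of
  \<open>P\<close>.\<close>

lemma P_mat_eps_A: "P_mat ** eps_A = adj_A ** (P_mat :: 'n::finite cmat)"
proof -
  have "(P_mat *v (eps_A *v v)) $ y = (adj_A *v (P_mat *v v)) $ y" for v :: "'n cvec" and y
  proof -
    have reindex: "(\<Sum>z\<in>UNIV. P_mat $ y $ z * (\<i> * (spin z k * v $ flip k z))) =
        (\<Sum>z\<in>UNIV. P_mat $ y $ flip k z * (\<i> * (spin (flip k z) k * v $ z)))" for k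
      using sum_flip_reindex[of "\<lambda>z. P_mat $ y $ flip k z * (\<i> * (spin (flip k z) k * v $ z))" k]
      by simp
    have "(P_mat *v (eps_A *v v)) $ y =
        (\<Sum>k\<in>UNIV. \<Sum>z\<in>UNIV. P_mat $ y $ z * (\<i> * (spin z k * v $ flip k z)))"
      by (subst sum.swap)
        (simp add: matrix_vector_mult_def[of P_mat] eps_A_apply sum_distrib_left)
    also have "\<dots> = (\<Sum>k\<in>UNIV. \<Sum>z\<in>UNIV. P_mat $ y $ flip k z * (\<i> * (spin (flip k z) k * v $ z)))"
      by (simp only: reindex)
    also have "\<dots> = (\<Sum>k\<in>UNIV. \<Sum>z\<in>UNIV. P_mat $ flip k y $ z * v $ z)"
      by (simp add: P_mat_flip_right P_mat_flip_left spin_flip mult_ac)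
    also have "\<dots> = (adj_A *v (P_mat *v v)) $ y"
      by (simp add: adj_A_apply matrix_vector_mult_def[of P_mat])
    finally show ?thesis .
  qed
  then have "P_mat *v (eps_A *v v) = adj_A *v (P_mat *v v)" for v :: "'n cvec"
    unfolding vec_eq_iff by blast
  then show ?thesis by (simp add: matrix_eq flip: matrix_vector_mul_assoc)
qed

lemma prod_sum_bool_vec:
  fixes f :: "'n::finite \<Rightarrow> bool \<Rightarrow> 'a::comm_semiring_1"
  shows "(\<Prod>k\<in>UNIV. \<Sum>b\<in>UNIV. f k b) = (\<Sum>z\<in>UNIV. \<Prod>k\<in>UNIV. f k (z $ k))"
proof -
  have "(\<Prod>k\<in>UNIV. \<Sum>b\<in>UNIV. f k b) = (\<Sum>g\<in>UNIV. \<Prod>k\<in>UNIV. f k (g k))"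
    by (simp add: prod_sum_PiE PiE_UNIV_domain)
  also have "\<dots> = (\<Sum>z\<in>UNIV. \<Prod>k\<in>UNIV. f k (z $ k))"
    by (rule sum.reindex_bij_witness[of _ vec_nth vec_lambda]) (auto simp: vec_lambda_inverse)
  finally show ?thesis .
qed

lemma invertible_P_mat: "invertible (P_mat :: 'n::finite cmat)"
proof -
  \<comment> \<open>The rows of \<open>P1\<close> are orthogonal of squared norm 2, so half its
    conjugate transpose inverts it; \<open>Q\<close> is the Kronecker power of that inverse.\<close>
  define Q :: "'n cmat" where "Q = (\<chi> z y. \<Prod>k\<in>UNIV. cnj (P1 (y $ k) (z $ k)) / 2)"
  have "(P_mat ** Q) $ y $ x = (mat 1 :: 'n cmat) $ y $ x" for x y
  proof -
    have "(P_mat ** Q) $ y $ x =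
        (\<Sum>z\<in>UNIV. \<Prod>k\<in>UNIV. P1 (y $ k) (z $ k) * (cnj (P1 (x $ k) (z $ k)) / 2))"
      by (simp only: matrix_matrix_mult_def P_mat_def Q_def vec_lambda_beta prod.distrib)
    also have "\<dots> = (\<Prod>k\<in>UNIV. \<Sum>b\<in>UNIV. P1 (y $ k) b * (cnj (P1 (x $ k) b) / 2))"
      by (rule prod_sum_bool_vec[symmetric])
    also have "\<dots> = (\<Prod>k\<in>UNIV. if y $ k = x $ k then 1 else 0)"
      by (intro prod.cong) (auto simp: UNIV_bool P1_def)
    also have "\<dots> = (mat 1 :: 'n cmat) $ y $ x"
      by (auto simp: mat_def vec_eq_iff intro!: prod_zero)
    finally show ?thesis .
  qed
  then have "P_mat ** Q = mat 1" unfolding vec_eq_iff by blast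
  then show ?thesis by (auto simp: invertible_right_inverse)
qed

lemma matrix_inv_P_mat:
  "matrix_inv P_mat ** P_mat = (mat 1 :: 'n::finite cmat)"
  "P_mat ** matrix_inv P_mat = (mat 1 :: 'n cmat)"
  using someI_ex[OF invertible_P_mat[where 'n = 'n, unfolded invertible_def]]
  by (simp_all add: matrix_inv_def)

section \<open>Spectral families of the three matrices\<close>

lemma dual_E_apply: "(dual_E i *v v) $ y = (if cube_dist base_vertex y = i then v $ y else 0)"
proof -
  have "(dual_E i *v v) $ y =
      (\<Sum>z\<in>UNIV. if z = y then (if cube_dist base_vertex y = i then v $ y else 0) else 0)"
    by (simp only: dual_E_def matrix_vector_mult_def vec_lambda_beta) (intro sum.cong, auto)
  then show ?thesis by simp
qed

lemma spectral_family_dual_E: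
  "spectral_family CARD('n) dual_A (dual_E :: nat \<Rightarrow> 'n::finite cmat)"
  unfolding spectral_family_def
proof (intro conjI allI impI)
  fix v :: "'n cvec"
  have "cube_dist base_vertex y \<le> CARD('n)" for y :: "'n vert"
    unfolding cube_dist_eq_card by (rule card_mono) auto
  then show "(\<Sum>k\<le>CARD('n). dual_E k *v v) = v"
    by (simp add: vec_eq_iff dual_E_apply)
next
  fix k and v :: "'n cvec"
  show "dual_A *v (dual_E k *v v) = weight CARD('n) k *s (dual_E k *v v)"
    "dual_E k *v (dual_A *v v) = weight CARD('n) k *s (dual_E k *v v)"
    by (auto simp: vec_eq_iff dual_E_apply dual_A_apply simp flip: theta_cube_dist theta_eq_weight)
qed

lemma spectral_family_cong:
  assumes "spectral_family D Y F" and "\<And>k. k \<le> D \<Longrightarrow> F k = G k"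
  shows "spectral_family D Y G"
  using assms by (simp add: spectral_family_def)

text \<open>Conjugation by \<open>P\<close> carries the diagonal family of \<open>dual_A\<close> to
  one for \<open>adj_A\<close>, and uniqueness identifies it with the product formula.\<close>

lemma spectral_family_idem_E:
  "spectral_family CARD('n) adj_A (idem_E :: nat \<Rightarrow> 'n::finite cmat)"
proof -
  have conj: "spectral_family CARD('n) adj_A (\<lambda>k. matrix_inv P_mat ** dual_E k ** P_mat :: 'n cmat)"
    by (rule spectral_family_conjugate[OF spectral_family_dual_E matrix_inv_P_mat P_mat_adj_A])
  have "lagrange CARD('n) adj_A i = (idem_E i :: 'n cmat)" for i
    by (simp only: idem_E_def lagrange_def theta_eq_weight)
  then show ?thesis
    using lagrange_spectral[OF conj] by (intro spectral_family_cong[OF conj]) simp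
qed

lemma spectral_family_eps_E:
  "spectral_family CARD('n) eps_A (eps_E :: nat \<Rightarrow> 'n::finite cmat)"
  using spectral_family_conjugate[OF spectral_family_idem_E matrix_inv_P_mat P_mat_eps_A]
  unfolding eps_E_def .

section \<open>\<open>T\<close>-modules and the three rotations\<close>

lemma T_moduleI:
  assumes U: "vec.subspace U" and A: "invariant_under U adj_A" "invariant_under U dual_A"
  shows "T_module U"
proof -
  have "invariant_under U M" if "M \<in> T_alg" for M
    using that
  proof induction
    case (mult M N)
    then show ?case by (auto simp: invariant_under_def simp flip: matrix_vector_mul_assoc)
  qed (use A in \<open>auto simp: invariant_under_def matrix_vector_mult_add_rdistrib mat_scale_mult_vec
      intro: vec.subspace_add[OF U] vec.subspace_scale[OF U]\<close>)
  then show ?thesis using U by (auto simp: T_module_def invariant_under_def)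
qed

lemma eps_A_in_T_alg: "eps_A \<in> T_alg"
proof -
  have commutator: "adj_A ** dual_A - dual_A ** adj_A = adj_A ** dual_A + mat_scale (- 1) (dual_A ** adj_A)"
    by (simp add: mat_scale_def vec_eq_iff)
  show ?thesis unfolding eps_A_def commutator by (intro T_alg.intros)
qed

theorem theorem10p3:
  fixes W :: "('n::finite) cvec set"
    and u u_dual u_eps :: "'n cvec"
    and r d :: nat
  assumes "irreducible_T_module W"
    and "r = endpoint W"
    and "d = module_diameter W"
    and "u \<in> (*v) (idem_E r) ` W" and "u \<noteq> 0"
    and "u_dual \<in> (*v) (dual_E r) ` W" and "u_dual \<noteq> 0"
    and "u_eps \<in> (*v) (eps_E r) ` W" and "u_eps \<noteq> 0"
  shows "represents d (B_mat d) adj_A (\<lambda>i. eps_E (r + i) *v u_dual) W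
       \<and> represents d (B_mat d) dual_A (\<lambda>i. idem_E (r + i) *v u_eps) W
       \<and> represents d (B_mat d) eps_A (\<lambda>i. dual_E (r + i) *v u) W"
proof -
  let ?D = "CARD('n)"
  have W: "vec.subspace W" "invariant_under W adj_A" "invariant_under W dual_A"
    "invariant_under W eps_A" and nz: "W \<noteq> {0}"
    using assms(1) eps_A_in_T_alg
    by (auto simp: irreducible_T_module_def T_module_def invariant_under_def intro: T_alg.intros)
  have irr: "U = {0} \<or> U = W"
    if "vec.subspace U" "U \<subseteq> W" "invariant_under U adj_A" "invariant_under U dual_A" for U
    using assms(1) that T_moduleI by (auto simp: irreducible_T_module_def)
  note triple = cyclic_triple_cube[where 'n = 'n]
  \<comment> \<open>The three rotations: \<open>A\<close> yields the matrix of \<open>eps_A\<close>,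
    \<open>A_dual\<close> that of \<open>adj_A\<close>, and \<open>A_eps\<close> that of
    \<open>dual_A\<close>.\<close>
  interpret A: irreducible_triple adj_A dual_A eps_A idem_E dual_E ?D W
    by (rule irreducible_triple.intro[OF triple spectral_family_idem_E spectral_family_dual_E
          W(1,2,3,4)]) (rule irr; assumption)
  interpret A_dual: irreducible_triple dual_A eps_A adj_A dual_E eps_E ?D W
    by (rule irreducible_triple.intro[OF cyclic_triple_rotate[OF triple]
          spectral_family_dual_E spectral_family_eps_E W(1,3,4,2)]) (rule irr; assumption)
  interpret A_eps: irreducible_triple eps_A adj_A dual_A eps_E idem_E ?D W
    by (rule irreducible_triple.intro[OF cyclic_triple_rotate[OF cyclic_triple_rotate[OF triple]]
          spectral_family_eps_E spectral_family_idem_E W(1,4,2,3)]) (rule irr; assumption)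
  \<comment> \<open>The supports are linked from \<open>dual_E\<close> to \<open>eps_E\<close> to
    \<open>idem_E\<close> and back to \<open>dual_E\<close>. Each becomes an interval fixed by the
    least element of the one before, so all three agree.\<close>
  obtain s where s: "2 * s \<le> ?D" and eps: "spectral_support ?D eps_E W = {s..?D - s}"
    using A_dual.support_F_from_support_E[OF nz] by metis
  have least: "t = s" if "t \<in> {s..?D - s}" "\<And>k. k < t \<Longrightarrow> k \<notin> {s..?D - s}" for t
    using that s by (metis atLeastAtMost_iff le_eq_less_or_eq order.trans order_refl)
  have idem: "spectral_support ?D idem_E W = {s..?D - s}"
    using A_eps.support_F_from_support_E[OF nz] eps least by metis
  then have dual: "spectral_support ?D dual_E W = {s..?D - s}"
    using A.support_F_from_support_E[OF nz] least by metis
  have support: "dual_support W = {s..?D - s}"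
    using dual by (simp add: dual_support_def spectral_support_def)
  have "Min {s..?D - s} = s" using s by (intro Min_eqI) auto
  then have r: "r = s" by (simp add: assms(2) endpoint_def support)
  \<comment> \<open>The support has \<open>?D - 2 * s + 1\<close> elements, and the diameter is one
    less.\<close>
  have d: "d = ?D - 2 * r" using s by (simp add: assms(3) module_diameter_def support r)
  have min: "r \<in> {s..?D - s}" "\<And>k. k < r \<Longrightarrow> k \<notin> {s..?D - s}" using s r by auto
  show ?thesis
    unfolding d
    using A_dual.represents_Z[unfolded dual, OF min assms(6,7)]
      A_eps.represents_Z[unfolded eps, OF min assms(8,9)]
      A.represents_Z[unfolded idem, OF min assms(4,5)]
    by blast
qed

end
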